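(* Let $(\mathcal{M}_{p,q})$, with $p,q$ ranging over the nonnegative integers, be the double sequence of real numbers determined by $\mathcal{M}_{p,q}=0$ if $p=0$ or $q=0$, and $$\mathcal{M}_{p,q}=\frac{(p-1)\mathcal{M}_{p-1,q}+(q-1)\mathcal{M}_{p,q-1}+|p-q|}{p+q-1}\qquad\text{for all integers } p,q\ge 1.$$ For integers $p,q\ge 1$ set $$\mathcal{L}_{p,q}=\frac{(p+q-1)!}{(p-1)!\,(q-1)!}\,\mathcal{M}_{p,q}.$$ Then for all integers $p,q\ge 0$, $$\mathcal{L}_{p+1,q+1}=\sum_{i=0}^{p}\sum_{j=0}^{q}|i-j|\binom{i+j}{i}\binom{p+q-i-j}{p-i},$$ and for all integers $p\ge 0$, $$\mathcal{L}_{p+1,p+1}=2^{2p-1}\,p,\qquad \mathcal{M}_{p+1,p+1}=2^{2p-1}\,p\,\frac{(p!)^2}{(2p+1)!}.$$ *)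

theory Defs
  imports Complex_Main
begin

(* The recursive equation is looping as a rewrite rule, hence removed from the simpset. *)
function M :: "nat \<Rightarrow> nat \<Rightarrow> real" where
  "M p q = (if p = 0 \<or> q = 0 then 0
            else ((real p - 1) * M (p - 1) q + (real q - 1) * M p (q - 1)
                   + \<bar>real p - real q\<bar>) / (real p + real q - 1))"
  by pat_completeness auto
termination by (relation "measure (\<lambda>(p, q). p + q)") auto

declare M.simps [simp del]

(* Meaningful for p, q \<ge> 1 only: the subtractions on nat truncate at 0. *)
definition L :: "nat \<Rightarrow> nat \<Rightarrow> real" where
  "L p q = fact (p + q - 1) / (fact (p - 1) * fact (q - 1)) * M p q"

end

theory Submission
  imports Defs "HOL-Computational_Algebra.Formal_Power_Series"
begin

text \<open>The argument is a count of monotone lattice paths. After multiplication by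
  \<open>(p + q + 1)! / (p! q!)\<close>, the recursion for \<open>M\<close> at \<open>(p + 1, q + 1)\<close> loses its weights and
  becomes Pascal's recursion with source term \<open>\<bar>p - q\<bar> (p + q choose p)\<close> (lemma \<open>L_rec\<close>).
  A Pascal recursion with a source is solved by superposition: each source contributes its value times the
  number of paths from its site to \<open>(p, q)\<close> (lemma \<open>path_sum_unique\<close>). This is the double sum.

  On the diagonal, the summand is \<open>\<bar>i - j\<bar> through p i j\<close>, where \<open>through p i j\<close> counts the paths
  from \<open>(0, 0)\<close> to \<open>(p, p)\<close> that pass through \<open>(i, j)\<close>. On an antidiagonal these counts form a
  hypergeometric distribution up to scaling, and the partial sums of its first moment have a
  closed form: \<open>p (j - i) through p i j\<close> is a difference of \<open>flow p\<close> at two neighbouring sites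
  (lemma \<open>flow_diff\<close>). Summed over \<open>i < j\<close>, everything cancels except the values of \<open>flow p\<close> at
  the sites \<open>(m, m)\<close> and \<open>(m + 1, m)\<close> (lemma \<open>upper_sum\<close>). These are products of two of the numbers
  \<open>dcentral m = (m + 1) (2m + 2 choose m + 1)\<close>, up to a factor \<open>1/4\<close> at the sites \<open>(m + 1, m)\<close>.

  The generating function of \<open>dcentral\<close> is \<open>2 (1 - 4x) powr (-3/2)\<close>, so its square is
  \<open>4 / (1 - 4x)^3\<close>, which evaluates the remaining convolutions
  (lemma \<open>dcentral_convolution\<close>). The even and the odd antidiagonals contribute multiples of
  \<open>p (p - 1)\<close> and \<open>p (p + 1)\<close>, whose sum is the required multiple of \<open>p^2\<close>.\<close>

section \<open>Lattice paths and the summation formula\<close>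

definition paths :: "nat \<Rightarrow> nat \<Rightarrow> real" where
  "paths i j = real ((i + j) choose i)"

lemma paths_rec:
  "paths x y = (if x = 0 then 0 else paths (x - 1) y) + (if y = 0 then 0 else paths x (y - 1))
               + (if x = 0 \<and> y = 0 then 1 else 0)"
  by (cases x; cases y) (auto simp: paths_def)

lemma paths_commute: "paths i j = paths j i"
  using binomial_symmetric[of i "i + j"] by (simp add: paths_def add.commute)

lemma paths_shift: "real (Suc i) * paths (Suc i) j = real (Suc j) * paths i (Suc j)"
proof -
  have "Suc i * (Suc (i + j) choose Suc i) = Suc j * (Suc (i + j) choose i)"
    using Suc_times_binomial[of i "i + j"] binomial_absorb_comp[of "Suc (i + j)" i]
    by (simp add: Suc_diff_le)
  then show ?thesis
    unfolding paths_def by (metis add_Suc add_Suc_right of_nat_mult)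
qed

text \<open>A path from \<open>(i, j)\<close> to \<open>(p, q)\<close> arrives by a step from \<open>(p - 1, q)\<close>, by a step from
  \<open>(p, q - 1)\<close>, or is empty; the three sums in the proof correspond to these cases.\<close>

lemma path_sum_unique:
  fixes l a :: "nat \<Rightarrow> nat \<Rightarrow> real"
  assumes rec: "\<And>p q. l p q = (if p = 0 then 0 else l (p - 1) q)
                              + (if q = 0 then 0 else l p (q - 1)) + a p q"
  shows "l p q = (\<Sum>i\<le>p. \<Sum>j\<le>q. a i j * paths (p - i) (q - j))"
proof (induction "p + q" arbitrary: p q rule: less_induct)
  case less
  have 1: "(\<Sum>i\<le>p. \<Sum>j\<le>q. a i j * (if p - i = 0 then 0 else paths (p - i - 1) (q - j)))
      = (if p = 0 then 0 else l (p - 1) q)"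
  proof (cases p)
    case (Suc p')
    have "(\<Sum>i\<le>p'. \<Sum>j\<le>q. a i j * (if p - i = 0 then 0 else paths (p - i - 1) (q - j)))
        = (\<Sum>i\<le>p'. \<Sum>j\<le>q. a i j * paths (p' - i) (q - j))"
      using Suc by (intro sum.cong refl) (simp add: Suc_diff_le)
    then show ?thesis using less[of p' q] Suc by simp
  qed auto
  have 2: "(\<Sum>i\<le>p. \<Sum>j\<le>q. a i j * (if q - j = 0 then 0 else paths (p - i) (q - j - 1)))
      = (if q = 0 then 0 else l p (q - 1))"
  proof (cases q)
    case (Suc q')
    have "(\<Sum>i\<le>p. \<Sum>j\<le>q'. a i j * (if q - j = 0 then 0 else paths (p - i) (q - j - 1)))
        = (\<Sum>i\<le>p. \<Sum>j\<le>q'. a i j * paths (p - i) (q' - j))"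
      using Suc by (intro sum.cong refl) (simp add: Suc_diff_le)
    then show ?thesis using less[of p q'] Suc by simp
  qed auto
  have 3: "(\<Sum>i\<le>p. \<Sum>j\<le>q. a i j * (if p - i = 0 \<and> q - j = 0 then 1 else 0)) = a p q"
  proof -
    have "(\<Sum>i\<le>p. \<Sum>j\<le>q. a i j * (if p - i = 0 \<and> q - j = 0 then 1 else 0))
        = (\<Sum>i\<le>p. \<Sum>j\<le>q. if j = q then if i = p then a i j else 0 else 0)"
      by (intro sum.cong refl) auto
    also have "\<dots> = a p q" by simp
    finally show ?thesis .
  qed
  have "(\<Sum>i\<le>p. \<Sum>j\<le>q. a i j * paths (p - i) (q - j))
     = (\<Sum>i\<le>p. \<Sum>j\<le>q. a i j * (if p - i = 0 then 0 else paths (p - i - 1) (q - j)))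
     + (\<Sum>i\<le>p. \<Sum>j\<le>q. a i j * (if q - j = 0 then 0 else paths (p - i) (q - j - 1)))
     + (\<Sum>i\<le>p. \<Sum>j\<le>q. a i j * (if p - i = 0 \<and> q - j = 0 then 1 else 0))"
    by (subst paths_rec) (simp only: distrib_left sum.distrib)
  also have "\<dots> = l p q" unfolding 1 2 3 by (rule rec[symmetric])
  finally show ?case by simp
qed

text \<open>The normalising factorials are chosen so that the weights \<open>p / (p + q + 1)\<close> and
  \<open>q / (p + q + 1)\<close> in the recursion for \<open>M\<close> cancel.\<close>

lemma L_rec:
  "L (p + 1) (q + 1) = (if p = 0 then 0 else L (p - 1 + 1) (q + 1))
     + (if q = 0 then 0 else L (p + 1) (q - 1 + 1)) + \<bar>real p - real q\<bar> * paths p q"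
proof -
  let ?A = "real p * M p (q + 1)" and ?B = "real q * M (p + 1) q"
  let ?c = "fact (p + q) / (fact p * fact q) :: real"
  have M: "real (p + q + 1) * M (p + 1) (q + 1) = ?A + ?B + \<bar>real p - real q\<bar>"
    by (subst M.simps) (simp add: field_simps)
  have "fact (p + 1 + (q + 1) - 1) = fact (p + q) * real (p + q + 1)"
    by simp
  then have "L (p + 1) (q + 1) = ?c * (real (p + q + 1) * M (p + 1) (q + 1))"
    unfolding L_def by (simp only: add_diff_cancel_right' times_divide_eq_left mult.assoc)
  also have "\<dots> = ?c * ?A + ?c * ?B + \<bar>real p - real q\<bar> * ?c"
    unfolding M by (simp add: algebra_simps)
  also have "?c * ?A = (if p = 0 then 0 else L (p - 1 + 1) (q + 1))"
    by (cases p) (simp_all add: L_def divide_simps)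
  also have "?c * ?B = (if q = 0 then 0 else L (p + 1) (q - 1 + 1))"
    by (cases q) (simp_all add: L_def divide_simps)
  also have "?c = paths p q"
    by (simp add: paths_def binomial_fact)
  finally show ?thesis .
qed

lemma L_eq_path_sum:
  "L (p + 1) (q + 1) =
     (\<Sum>i\<le>p. \<Sum>j\<le>q. \<bar>real i - real j\<bar> * paths i j * paths (p - i) (q - j))"
  using path_sum_unique[of "\<lambda>p q. L (p + 1) (q + 1)" "\<lambda>p q. \<bar>real p - real q\<bar> * paths p q", OF L_rec]
  by simp

section \<open>A convolution of central binomial coefficients\<close>

text \<open>These are the coefficients of the derivative of \<open>1 / sqrt (1 - 4x)\<close>, the generating function
  of the central binomial coefficients.\<close>

definition dcentral :: "nat \<Rightarrow> real" where "dcentral m = real (Suc m) * paths (Suc m) (Suc m)"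

text \<open>By symmetry, each of the two possible last steps into a diagonal site
  occurs in half of the paths to it.\<close>

lemma dcentral_half: "real (Suc m) * paths (Suc m) m = dcentral m / 2"
  "real (Suc m) * paths m (Suc m) = dcentral m / 2"
proof -
  have "paths (Suc m) (Suc m) = 2 * paths (Suc m) m"
    using paths_rec[of "Suc m" "Suc m"] paths_commute[of m "Suc m"] by simp
  then show half: "real (Suc m) * paths (Suc m) m = dcentral m / 2"
    by (simp add: dcentral_def)
  show "real (Suc m) * paths m (Suc m) = dcentral m / 2"
    unfolding half[symmetric] by (simp only: paths_commute[of m "Suc m"])
qed

lemma dcentral_Suc: "real (Suc m) * dcentral (Suc m) = 2 * real (2 * m + 3) * dcentral m"
proof -
  have sums: "Suc (Suc m) + Suc m = Suc (2 * m + 2)" "Suc m + Suc m = 2 * m + 2"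
    by simp_all
  have "dcentral (Suc m) / 2 = real (Suc (Suc m) * (Suc (2 * m + 2) choose Suc (Suc m)))"
    by (simp only: dcentral_half(1)[symmetric] paths_def of_nat_mult sums)
  also have "\<dots> = real (Suc (2 * m + 2)) * paths (Suc m) (Suc m)"
    unfolding Suc_times_binomial paths_def of_nat_mult sums by (rule refl)
  finally have "dcentral (Suc m) = 2 * real (2 * m + 3) * paths (Suc m) (Suc m)"
    by simp
  then show ?thesis
    by (simp only: dcentral_def mult_ac)
qed

lemma dcentral_gbinomial: "dcentral m = 2 * (-4) ^ m * ((-3/2) gchoose m)"
proof (induction m)
  case (Suc m)
  have rec: "real (Suc m) * ((-3/2) gchoose Suc m) = (-3/2 - real m) * ((-3/2) gchoose m)"
    using gbinomial_mult_1[of "-3/2::real" m] by (simp add: algebra_simps)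
  have "real (Suc m) * (2 * (-4) ^ Suc m * ((-3/2) gchoose Suc m))
      = 2 * (-4) ^ Suc m * (real (Suc m) * ((-3/2) gchoose Suc m))"
    by (simp only: mult.left_commute)
  also have "\<dots> = real (Suc m) * dcentral (Suc m)"
    unfolding rec dcentral_Suc Suc.IH by (simp add: algebra_simps)
  finally show ?case by (simp del: of_nat_Suc power_Suc)
qed (simp add: dcentral_def paths_def)

text \<open>By Vandermonde's identity, which is the coefficient form of
  \<open>(1 - 4x) powr (-3/2) * (1 - 4x) powr (-3/2) = (1 - 4x) powr (-3)\<close>.\<close>

lemma dcentral_convolution: "(\<Sum>m\<le>k. dcentral m * dcentral (k - m)) = 2 * 4 ^ k * real ((k + 1) * (k + 2))"
proof -
  have "(\<Sum>m\<le>k. dcentral m * dcentral (k - m))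
     = (\<Sum>m\<le>k. 4 * (-4)^k * (((-3/2) gchoose m) * ((-3/2) gchoose (k - m))))"
    by (intro sum.cong refl) (simp add: dcentral_gbinomial flip: power_add)
  also have "\<dots> = 4 * (-4)^k * ((-3/2 + -3/2) gchoose k)"
    unfolding sum_distrib_left[symmetric] 
    using gbinomial_Vandermonde[of "-3/2::real" "-3/2" k] by (simp add: atLeast0AtMost)
  also have "(-3/2 + -3/2 :: real) = -3" by simp
  also have "(-3::real) gchoose k = (-1)^k * real ((k + 2) choose k)"
    using gbinomial_minus[of "3::real" k] by (simp add: binomial_gbinomial algebra_simps)
  also have "real ((k + 2) choose k) = real ((k + 1) * (k + 2)) / 2"
  proof -
    have "(k + 2) choose k = (k + 2) choose 2" using binomial_symmetric[of k "k+2"] by simp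
    also have "real \<dots> = real ((k + 1) * (k + 2)) / 2" by (simp add: choose_two real_of_nat_div)
    finally show ?thesis .
  qed
  finally show ?thesis by (simp flip: power_mult_distrib)
qed

section \<open>The diagonal\<close>

definition through where "through p i j = paths i j * paths (p - i) (p - j)"
definition flow where "flow p i j = real i * real (p - j) * through p i j"

lemma through_commute: "through p i j = through p j i"
  unfolding through_def by (metis paths_commute)

text \<open>Moving from \<open>(i, j)\<close> to \<open>(i + 1, j - 1)\<close> changes both path counts by simple ratios
  (\<open>paths_shift\<close>), and these turn \<open>flow p (i + 1) (j - 1)\<close> into \<open>j (p - i) through p i j\<close>. The
  claim is then \<open>j (p - i) - i (p - j) = p (j - i)\<close>.\<close>

lemma flow_diff:
  assumes "i < j" "j \<le> p"
  shows "real p * (real j - real i) * through p i j = flow p (i + 1) (j - 1) - flow p i j"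
proof -
  obtain b where b: "j = Suc b" using assms by (cases j) auto
  obtain x y where x: "p - i = Suc x" "p - Suc i = x" and y: "p - j = y" "p - b = Suc y"
    using assms b by (metis Suc_diff_Suc Suc_le_lessD less_le_trans)
  have "flow p (i + 1) (j - 1) = (real (Suc i) * paths (Suc i) b) * (real (Suc y) * paths x (Suc y))"
    by (simp add: flow_def through_def b x y)
  also have "\<dots> = (real (Suc b) * paths i (Suc b)) * (real (Suc x) * paths (Suc x) y)"
    by (simp only: paths_shift)
  also have "\<dots> = real j * real (p - i) * through p i j"
    by (simp add: through_def b x y[unfolded b])
  finally show ?thesis using assms 
    by (simp add: flow_def of_nat_diff algebra_simps)
qed

lemma flow_even: "0 < m \<Longrightarrow> m < p \<Longrightarrow> flow p m m = dcentral (m - 1) * dcentral (p - 1 - m)"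
proof -
  assume "0 < m" "m < p"
  then obtain a b where "m = Suc a" "p - Suc a = Suc b" "p - Suc (Suc a) = b"
    by (metis Suc_diff_Suc gr0_implies_Suc)
  then show ?thesis by (simp add: flow_def through_def dcentral_def)
qed

lemma flow_odd: "m < p \<Longrightarrow> flow p (Suc m) m = dcentral m * dcentral (p - 1 - m) / 4"
proof -
  assume "m < p"
  then obtain b where b: "p - m = Suc b" "p - Suc m = b"
    by (metis Suc_diff_Suc)
  have "flow p (Suc m) m = (real (Suc m) * paths (Suc m) m) * (real (Suc b) * paths b (Suc b))"
    by (simp add: flow_def through_def b)
  also have "\<dots> = dcentral m * dcentral b / 4" unfolding dcentral_half by simp
  finally show ?thesis using b by simp
qed

text \<open>Telescoping along all antidiagonals at once: the sites \<open>(i, j)\<close> with \<open>i < j \<le> p\<close>, shifted by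
  \<open>(1, -1)\<close>, are the same sites again, except that those on the borders \<open>i = 0\<close> and \<open>j = p\<close>,
  where \<open>flow p\<close> vanishes, are lost and those on and just below the diagonal are gained.\<close>

lemma upper_sum:
  "real p * (\<Sum>(i,j)\<in>{(i,j). i < j \<and> j \<le> p}. (real j - real i) * through p i j)
     = (\<Sum>m\<in>{1..<p}. flow p m m) + (\<Sum>m<p. flow p (Suc m) m)"
proof -
  let ?A = "{(i,j). i < j \<and> j \<le> p}"
  let ?C = "{(i,j). 0 < i \<and> i < j \<and> j < p}"
  let ?D = "(\<lambda>m. (m, m)) ` {1..<p}" and ?E = "(\<lambda>m. (Suc m, m)) ` {..<p}"
  have fin: "finite ?A" by (rule finite_subset[of _ "{..p} \<times> {..p}"]) auto
  have finC: "finite ?C" by (rule finite_subset[OF _ fin]) auto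
  have "real p * (\<Sum>(i,j)\<in>?A. (real j - real i) * through p i j)
      = (\<Sum>(i,j)\<in>?A. flow p (i + 1) (j - 1) - flow p i j)"
    unfolding sum_distrib_left
    by (intro sum.cong refl) (clarsimp simp: flow_diff[symmetric, simplified] mult.assoc)
  also have "\<dots> = (\<Sum>(i,j)\<in>?A. flow p (i + 1) (j - 1)) - (\<Sum>(i,j)\<in>?A. flow p i j)"
    by (simp add: case_prod_unfold sum_subtractf)
  also have "(\<Sum>(i,j)\<in>?A. flow p i j) = (\<Sum>(i,j)\<in>?C. flow p i j)"
    by (rule sum.mono_neutral_right[OF fin]) (auto simp: flow_def)
  also have "(\<Sum>(i,j)\<in>?A. flow p (i + 1) (j - 1)) = (\<Sum>(i,j)\<in>?C \<union> (?D \<union> ?E). flow p i j)"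
    by (rule sum.reindex_bij_witness[of _ "\<lambda>(i,j). (i - 1, j + 1)" "\<lambda>(i,j). (i + 1, j - 1)"])
       (auto simp: image_iff)
  also have "\<dots> = (\<Sum>(i,j)\<in>?C. flow p i j) + ((\<Sum>(i,j)\<in>?D. flow p i j) + (\<Sum>(i,j)\<in>?E. flow p i j))"
    using finC by (subst sum.union_disjoint; (subst sum.union_disjoint)?) auto
  also have "(\<Sum>(i,j)\<in>?D. flow p i j) = (\<Sum>m\<in>{1..<p}. flow p m m)"
    by (subst sum.reindex) (auto simp: inj_on_def)
  also have "(\<Sum>(i,j)\<in>?E. flow p i j) = (\<Sum>m<p. flow p (Suc m) m)"
    by (subst sum.reindex) (auto simp: inj_on_def)
  finally show ?thesis by simp
qed

lemma upper_sum_value: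
  "(\<Sum>(i,j)\<in>{(i,j). i < j \<and> j \<le> p}. (real j - real i) * through p i j) = 4 ^ p * real p / 4"
proof (cases p)
  case (Suc k)
  have odd: "(\<Sum>m<p. flow p (Suc m) m) = 4 ^ k * real ((k + 1) * (k + 2)) / 2"
  proof -
    have "(\<Sum>m<p. flow p (Suc m) m) = (\<Sum>m\<le>k. dcentral m * dcentral (k - m)) / 4"
      unfolding Suc lessThan_Suc_atMost sum_divide_distrib
      by (intro sum.cong refl) (simp add: flow_odd)
    then show ?thesis by (simp add: dcentral_convolution)
  qed
  have even: "(\<Sum>m\<in>{1..<p}. flow p m m) = 4 ^ k * real (k * (k + 1)) / 2"
  proof (cases k)
    case 0 then show ?thesis using Suc by simp
  next
    case (Suc r)
    have "(\<Sum>m\<in>{1..<p}. flow p m m) = (\<Sum>m\<le>r. dcentral m * dcentral (r - m))"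
      using \<open>p = Suc k\<close> Suc
      by (intro sum.reindex_bij_witness[of _ Suc "\<lambda>m. m - 1"]) (auto simp: flow_even)
    then show ?thesis by (simp add: dcentral_convolution Suc)
  qed
  have "real p * (\<Sum>(i,j)\<in>{(i,j). i < j \<and> j \<le> p}. (real j - real i) * through p i j)
      = real p * (4 ^ p * real p / 4)"
    unfolding upper_sum odd even by (simp add: Suc field_simps)
  then show ?thesis using Suc by simp
next
  case 0
  then have "{(i,j). i < j \<and> j \<le> p} = {}" by auto
  then show ?thesis using 0 by (simp only: sum.empty)
qed

lemma L_diagonal: "L (p + 1) (p + 1) = 4 ^ p * real p / 2"
proof -
  let ?f = "\<lambda>(i,j). \<bar>real i - real j\<bar> * through p i j"
  let ?U = "{(i,j). i < j \<and> j \<le> p}" and ?V = "{(i,j). j < i \<and> i \<le> p}" 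
  let ?D = "(\<lambda>m. (m, m)) ` {..p}"
  have fin: "finite ?U" "finite ?V" 
    by (rule finite_subset[of _ "{..p} \<times> {..p}"], auto)+
  have "L (p + 1) (p + 1) = (\<Sum>x\<in>{..p} \<times> {..p}. ?f x)"
    unfolding L_eq_path_sum by (simp add: through_def sum.cartesian_product mult.assoc)
  also have "{..p} \<times> {..p} = ?U \<union> (?V \<union> ?D)"
    by (auto simp: image_iff)
  also have "sum ?f \<dots> = sum ?f ?U + (sum ?f ?V + sum ?f ?D)"
    using fin by (subst sum.union_disjoint; (subst sum.union_disjoint)?) auto
  also have "sum ?f ?D = 0" by (rule sum.neutral) auto
  also have "sum ?f ?V = sum ?f ?U"
    by (rule sum.reindex_bij_witness[of _ prod.swap prod.swap]) (auto simp: through_commute abs_minus_commute)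
  also have "sum ?f ?U = (\<Sum>(i,j)\<in>?U. (real j - real i) * through p i j)"
    by (intro sum.cong refl) auto
  finally show ?thesis by (simp add: upper_sum_value)
qed

theorem mainTheorem3:
  shows "(\<forall>p q :: nat. L (p + 1) (q + 1) =
            (\<Sum>i = 0..p. \<Sum>j = 0..q.
               \<bar>real i - real j\<bar> * real ((i + j) choose i)
                 * real ((p + q - i - j) choose (p - i))))
       \<and> (\<forall>p :: nat. L (p + 1) (p + 1) = 2 powi (2 * int p - 1) * real p)
       \<and> (\<forall>p :: nat. M (p + 1) (p + 1) =
            2 powi (2 * int p - 1) * real p * ((fact p)\<^sup>2 / fact (2 * p + 1)))"
proof (intro conjI allI)
  fix p q :: nat
  have "p - i + (q - j) = p + q - i - j" if "i \<le> p" "j \<le> q" for i j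
    using that by simp
  then show "L (p + 1) (q + 1) =
            (\<Sum>i = 0..p. \<Sum>j = 0..q.
               \<bar>real i - real j\<bar> * real ((i + j) choose i)
                 * real ((p + q - i - j) choose (p - i)))"
    unfolding L_eq_path_sum paths_def atLeast0AtMost by (intro sum.cong refl) simp
next
  fix p :: nat
  have "(2::real) powi (2 * int p - 1) = 4 ^ p / 2"
    by (simp add: power_int_diff power_int_mult)
  then show L: "L (p + 1) (p + 1) = 2 powi (2 * int p - 1) * real p"
    by (simp only: L_diagonal times_divide_eq_left)
  define F f :: real where "F = fact (2 * p + 1)" and "f = (fact p)\<^sup>2"
  have nonzero: "F \<noteq> 0" "f \<noteq> 0"
    by (simp_all only: F_def f_def fact_nonzero power_not_zero not_False_eq_True)
  have "p + 1 + (p + 1) - 1 = 2 * p + 1"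
    by simp
  then have "L (p + 1) (p + 1) = F / f * M (p + 1) (p + 1)"
    by (simp only: L_def F_def f_def add_diff_cancel_right' power2_eq_square)
  then have "M (p + 1) (p + 1) = L (p + 1) (p + 1) * (f / F)"
    using nonzero by (simp only: divide_simps) simp
  then show "M (p + 1) (p + 1) =
            2 powi (2 * int p - 1) * real p * ((fact p)\<^sup>2 / fact (2 * p + 1))"
    unfolding L F_def f_def .
qed

end
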